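(* Group Affine Scale Invariance (GASI) is preserved by Integrated Gradients (IG), but not by Baseline Shapley (BShap). That is: (1) For every $m\ge1$, every group structure $B=\{B_1,\dots,B_l\}$ on $M=\{1,\dots,m\}$, every group $B_i$, every invertible real $|B_i|\times|B_i|$ matrix $\mathbf A$ and vector $\mathbf b\in\mathbb{R}^{|B_i|}$, and every $\overline{\mathbf x},\mathbf x'\in\mathbb{R}^m$ and $f\in\mathcal F$, $$\mathrm{IG}_{B_i}(\overline{\mathbf x},\mathbf x',f)=\mathrm{IG}_{B_i}\bigl(\mathbf h(\overline{\mathbf x}),\mathbf h(\mathbf x'),f\circ\mathbf h^{-1}\bigr),\qquad \mathbf h(\mathbf x)=(\mathbf A\mathbf x_{B_i}+\mathbf b,\ \mathbf x_\neg).$$ (2) The corresponding statement for BShap is false: there exist $m$, a group structure $B$ on $\{1,\dots,m\}$, a group $B_i$, an invertible matrix $\mathbf A$, a vector $\mathbf b$, points $\overline{\mathbf x},\mathbf x'\in\mathbb{R}^m$ and $f\in\mathcal F$ such that, with $\mathbf h$ as in (1), $$\mathrm{BS}_{B_i}(\overline{\mathbf x},\mathbf x',f)\neq\mathrm{BS}_{B_i}\bigl(\mathbf h(\overline{\mathbf x}),\mathbf h(\mathbf x'),f\circ\mathbf h^{-1}\bigr).$$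
   Context: $\mathcal F$ is a class of functions $f:\mathbb{R}^m\to\mathbb{R}$, assumed differentiable almost everywhere. A group structure on $M=\{1,\dots,m\}$ is a partition $B=\{B_1,\dots,B_l\}$ of $M$ into pairwise disjoint nonempty sets with union $M$. For a group $B_i$ write $\mathbf x=(\mathbf x_{B_i},\mathbf x_\neg)$, where $\mathbf x_\neg$ collects the coordinates outside $B_i$. Since $\mathbf A$ is invertible, the group affine transformation $\mathbf h$ is invertible. A method $\mathcal A$ (assigning group attributions $\mathcal A_{B_i}(\overline{\mathbf x},\mathbf x',f)$) preserves GASI if for any group $B_i$, any invertible $\mathbf A$ and any $\mathbf b$, $\mathcal A_{B_i}(\overline{\mathbf x},\mathbf x',f)=\mathcal A_{B_i}(\mathbf h(\overline{\mathbf x}),\mathbf h(\mathbf x'),f\circ\mathbf h^{-1})$. Integrated Gradients: for $j\in M$, $$\mathrm{IG}_j(\overline{\mathbf x},\mathbf x',f)=(\overline x_j-x'_j)\int_0^1\frac{\partial f}{\partial x_j}\bigl(\mathbf x'+t(\overline{\mathbf x}-\mathbf x')\bigr)\,dt.$$ Baseline Shapley: for $j\in M$, $$\mathrm{BS}_j(\overline{\mathbf x},\mathbf x',f)=\sum_{S\subseteq M\setminus\{j\}}\frac{|S|!\,(m-|S|-1)!}{m!}\bigl(v(S\cup\{j\})-v(S)\bigr),$$ where $v(S)=f(\overline{\mathbf x}_S;\mathbf x'_{M\setminus S})$ is the value of $f$ at the point whose $k$-th coordinate is $\overline x_k$ if $k\in S$ and $x'_k$ otherwise. Group attributions of these methods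 are sums of individual ones: $\mathrm{IG}_{B_i}=\sum_{j\in B_i}\mathrm{IG}_j$ and $\mathrm{BS}_{B_i}=\sum_{j\in B_i}\mathrm{BS}_j$.
   Formalization: Part (1) additionally assumes that f is differentiable at almost every point of the segment from x' to x-bar and that the integrals defining IG_j for j in B_i exist; without this the claim can be false or undefined. *)

theory Defs
  imports
    "HOL-Library.Disjoint_Sets"
    "HOL-Analysis.Henstock_Kurzweil_Integration"
    "HOL-Analysis.Finite_Product_Measure"
    "Jordan_Normal_Form.DL_Missing_Sublist"
    "Jordan_Normal_Form.Matrix"
begin

unbundle no vec_syntax and no inner_syntax

text \<open>
  Points of \<open>\<real>\<^sup>m\<close> are the elements of \<open>carrier_vec m\<close>, with coordinates indexed by \<open>{..<m}\<close>
  instead of \<open>{1..m}\<close>. A function \<open>\<real>\<^sup>m \<rightarrow> \<real>\<close> is a function on \<open>real vec\<close>; its values outside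
  \<open>carrier_vec m\<close> are never used.
\<close>

definition euclid_norm :: "real vec \<Rightarrow> real" where
  "euclid_norm v = sqrt (v \<bullet> v)"

text \<open>Frechet differentiability; the library's \<open>has_derivative\<close> needs a normed space as domain type,
  which \<open>real vec\<close> (vectors of all dimensions) is not. Compare \<open>has_derivative_within_alt\<close>.\<close>

definition differentiable_in :: "nat \<Rightarrow> (real vec \<Rightarrow> real) \<Rightarrow> real vec \<Rightarrow> bool" where
  "differentiable_in m f x \<longleftrightarrow>
     (\<exists>g \<in> carrier_vec m. \<forall>e > 0. \<exists>d > 0. \<forall>y \<in> carrier_vec m.
        euclid_norm (y - x) < d \<longrightarrow> \<bar>f y - f x - g \<bullet> (y - x)\<bar> \<le> e * euclid_norm (y - x))"

text \<open>The product measure lives on the extensional functions \<open>{..<m} \<rightarrow>\<^sub>E UNIV\<close>, which \<open>vec m\<close>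
  identifies with \<open>carrier_vec m\<close>.\<close>

definition ae_differentiable :: "nat \<Rightarrow> (real vec \<Rightarrow> real) set" where
  "ae_differentiable m =
     {f. AE z in PiM {..<m} (\<lambda>_. lborel :: real measure). differentiable_in m f (vec m z)}"

definition partial_deriv :: "nat \<Rightarrow> (real vec \<Rightarrow> real) \<Rightarrow> nat \<Rightarrow> real vec \<Rightarrow> real" where
  "partial_deriv m f j x = deriv (\<lambda>s. f (x + s \<cdot>\<^sub>v unit_vec m j)) 0"

definition IG :: "nat \<Rightarrow> nat \<Rightarrow> real vec \<Rightarrow> real vec \<Rightarrow> (real vec \<Rightarrow> real) \<Rightarrow> real" where
  "IG m j x x' f =
     (x $ j - x' $ j) * integral {0..1} (\<lambda>t. partial_deriv m f j (x' + t \<cdot>\<^sub>v (x - x')))"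

definition IG_group :: "nat \<Rightarrow> nat set \<Rightarrow> real vec \<Rightarrow> real vec \<Rightarrow> (real vec \<Rightarrow> real) \<Rightarrow> real" where
  "IG_group m G x x' f = (\<Sum>j\<in>G. IG m j x x' f)"

text \<open>The integration path is a null set when \<open>m \<ge> 2\<close>, so membership in \<open>ae_differentiable m\<close> says
  nothing about the derivatives occurring in \<open>IG\<close>, and \<open>deriv\<close> and \<open>integral\<close> return arbitrary
  values where they are undefined. This predicate says that the attribution of the group \<open>G\<close> is
  meaningful: \<open>f\<close> is differentiable at almost every point of the path, and the integrals exist.\<close>

definition IG_well_defined :: "nat \<Rightarrow> nat set \<Rightarrow> real vec \<Rightarrow> real vec \<Rightarrow> (real vec \<Rightarrow> real) \<Rightarrow> bool" where
  "IG_well_defined m G x x' f \<longleftrightarrow>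
     (AE t in lborel. t \<in> {0..1} \<longrightarrow> differentiable_in m f (x' + t \<cdot>\<^sub>v (x - x'))) \<and>
     (\<forall>j\<in>G. (\<lambda>t. partial_deriv m f j (x' + t \<cdot>\<^sub>v (x - x'))) integrable_on {0..1})"

definition BS :: "nat \<Rightarrow> nat \<Rightarrow> real vec \<Rightarrow> real vec \<Rightarrow> (real vec \<Rightarrow> real) \<Rightarrow> real" where
  "BS m j x x' f =
     (let v = (\<lambda>S. f (vec m (\<lambda>k. if k \<in> S then x $ k else x' $ k)))
      in \<Sum>S \<in> Pow ({..<m} - {j}).
           fact (card S) * fact (m - card S - 1) / fact m * (v (S \<union> {j}) - v S))"

definition BS_group :: "nat \<Rightarrow> nat set \<Rightarrow> real vec \<Rightarrow> real vec \<Rightarrow> (real vec \<Rightarrow> real) \<Rightarrow> real" where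
  "BS_group m G x x' f = (\<Sum>j\<in>G. BS m j x x' f)"

text \<open>\<open>pick G r\<close> is the element number \<open>r\<close> of \<open>G\<close> in increasing order, starting with \<open>r = 0\<close>.\<close>

definition group_part :: "nat set \<Rightarrow> real vec \<Rightarrow> real vec" where
  "group_part G x = vec (card G) (\<lambda>r. x $ pick G r)"

text \<open>The map \<open>(x\<^sub>G, x\<^sub>\<not>) \<mapsto> (A x\<^sub>G + b, x\<^sub>\<not>)\<close>; a coordinate \<open>k \<in> G\<close> has position
  \<open>card {j \<in> G. j < k}\<close> within \<open>G\<close>.\<close>

definition group_affine ::
    "nat \<Rightarrow> nat set \<Rightarrow> real mat \<Rightarrow> real vec \<Rightarrow> real vec \<Rightarrow> real vec" where
  "group_affine m G A b x =
     vec m (\<lambda>k. if k \<in> G then (A *\<^sub>v group_part G x + b) $ card {j \<in> G. j < k} else x $ k)"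

definition group_affine_inv ::
    "nat \<Rightarrow> nat set \<Rightarrow> real mat \<Rightarrow> real vec \<Rightarrow> real vec \<Rightarrow> real vec" where
  "group_affine_inv m G A b = inv_into (carrier_vec m) (group_affine m G A b)"

end

theory Submission
  imports Defs "HOL-Analysis.Equivalence_Lebesgue_Henstock_Integration"
begin

unbundle no vec_syntax

text \<open>
  Part (1) is the chain rule. The map \<open>h\<close> sends the straight integration path to the straight path
  between the images, so at each path point where \<open>f\<close> is differentiable the gradient of \<open>f \<circ> h\<inverse>\<close>
  in the group coordinates is the old one multiplied by \<open>A\<inverse>\<close>, while the displacement is multiplied
  by \<open>A\<close>; the two matrices cancel in the sum over the group.

  For part (2) the group must be neither a singleton nor everything, and a function of degree 2 does
  not suffice, since the Shapley value splits a product of a group and a non-group coordinate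
  evenly. The counterexample is \<open>x\<^sub>0 x\<^sub>1 x\<^sub>2\<close> at \<open>(1, 1, 1)\<close> with baseline \<open>0\<close> and group \<open>{0, 1}\<close>: it
  attributes \<open>2/3\<close> to the group, but after \<open>x\<^sub>0 \<mapsto> x\<^sub>0 + x\<^sub>1\<close> the function becomes
  \<open>(y\<^sub>0 - y\<^sub>1) y\<^sub>1 y\<^sub>2\<close> with end point \<open>(2, 1, 1)\<close> and the attribution becomes \<open>5/6\<close>.
\<close>

section \<open>Group coordinates and their positions in the submatrix\<close>

definition pos :: "nat set \<Rightarrow> nat \<Rightarrow> nat" where
  "pos G k = card {j \<in> G. j < k}"

lemma pos_less_card: "finite G \<Longrightarrow> k \<in> G \<Longrightarrow> pos G k < card G"
  unfolding pos_def by (rule psubset_card_mono) auto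

lemma pos_pick: "r < card G \<Longrightarrow> pos G (pick G r) = r"
  by (simp add: pos_def card_pick_le)

lemma pick_pos: "k \<in> G \<Longrightarrow> pick G (pos G k) = k"
  by (simp add: pos_def pick_card_in_set)

lemma bij_betw_pick:
  assumes "finite G"
  shows "bij_betw (pick G) {0..<card G} G"
  by (rule bij_betw_byWitness[where f' = "pos G"])
    (use assms in \<open>auto simp: pos_pick pick_pos pick_in_set_le pos_less_card\<close>)

lemma pos_inj: "k \<in> G \<Longrightarrow> j \<in> G \<Longrightarrow> pos G k = pos G j \<longleftrightarrow> k = j"
  by (metis pick_pos)

text \<open>Matrix entries are indexed by positions, vector entries by coordinates. The summand
  takes both, so that sums coming from matrix products can be rewritten as sums over
  \<open>G\<close> itself and \<open>pick\<close> disappears from the later calculations.\<close>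

lemma sum_pick:
  assumes "finite G"
  shows "(\<Sum>r = 0..<card G. F r (pick G r)) = (\<Sum>l\<in>G. F (pos G l) l)"
proof -
  have "(\<Sum>l\<in>G. F (pos G l) l) = (\<Sum>r = 0..<card G. F (pos G (pick G r)) (pick G r))"
    by (rule sum.reindex_bij_betw[OF bij_betw_pick[OF assms], symmetric])
  also have "\<dots> = (\<Sum>r = 0..<card G. F r (pick G r))"
    by (rule sum.cong) (auto simp: pos_pick)
  finally show ?thesis by simp
qed

section \<open>The group affine map in coordinates and its inverse\<close>

lemma group_affine_carrier [simp]: "group_affine m G A b x \<in> carrier_vec m"
  by (simp add: group_affine_def)

lemma group_affine_dim [simp]: "dim_vec (group_affine m G A b x) = m"
  by (simp add: group_affine_def)

lemma group_affine_index_notin: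
  "k < m \<Longrightarrow> k \<notin> G \<Longrightarrow> group_affine m G A b x $ k = x $ k"
  by (simp add: group_affine_def)

lemma group_affine_index:
  assumes "G \<subseteq> {..<m}" "A \<in> carrier_mat (card G) (card G)" "b \<in> carrier_vec (card G)" "k \<in> G"
  shows "group_affine m G A b x $ k =
    (\<Sum>l\<in>G. A $$ (pos G k, pos G l) * x $ l) + b $ pos G k"
proof -
  have fin: "finite G" using assms(1) finite_subset by blast
  have "k < m" using assms by auto
  then have "group_affine m G A b x $ k =
      (\<Sum>r = 0..<card G. A $$ (pos G k, r) * x $ pick G r) + b $ pos G k"
    using assms pos_less_card[OF fin assms(4), unfolded pos_def]
    by (auto simp: group_affine_def group_part_def scalar_prod_def pos_def intro!: sum.cong)
  then show ?thesis
    using sum_pick[OF fin, of "\<lambda>r l. A $$ (pos G k, r) * x $ l"] by simp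
qed

text \<open>An entry of \<open>A * C\<close>, with the summation index moved from positions to group
  coordinates. It is applied with the two matrices in either order.\<close>

lemma sum_mat_inverse:
  assumes "finite G" "A \<in> carrier_mat (card G) (card G)" "C \<in> carrier_mat (card G) (card G)"
    and "A * C = 1\<^sub>m (card G)" "k \<in> G" "j \<in> G"
  shows "(\<Sum>l\<in>G. A $$ (pos G k, pos G l) * C $$ (pos G l, pos G j)) = (if k = j then 1 else (0::real))"
proof -
  have lt: "pos G k < card G" "pos G j < card G" using assms pos_less_card by auto
  have "(A * C) $$ (pos G k, pos G j) = (\<Sum>r = 0..<card G. A $$ (pos G k, r) * C $$ (r, pos G j))"
    using assms(2,3) lt by (auto simp: scalar_prod_def intro!: sum.cong)
  also have "\<dots> = (\<Sum>l\<in>G. A $$ (pos G k, pos G l) * C $$ (pos G l, pos G j))"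
    using sum_pick[OF assms(1), of "\<lambda>r l. A $$ (pos G k, r) * C $$ (r, pos G j)"] by simp
  finally show ?thesis unfolding assms(4) using lt pos_inj[OF assms(5,6)] by simp
qed

text \<open>Subtracting \<open>b\<close> from the group part of the image and applying
  \<open>C\<close> recovers every group coordinate; the other coordinates are not changed by the
  map.\<close>

lemma inj_on_group_affine:
  assumes G: "G \<subseteq> {..<m}" and A: "A \<in> carrier_mat (card G) (card G)" and b: "b \<in> carrier_vec (card G)"
    and C: "C \<in> carrier_mat (card G) (card G)" and CA: "C * A = 1\<^sub>m (card G)"
  shows "inj_on (group_affine m G A b) (carrier_vec m)"
proof (rule inj_onI)
  fix x y assume xy: "x \<in> carrier_vec m" "y \<in> carrier_vec m"
    and eq: "group_affine m G A b x = group_affine m G A b y"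
  have fin: "finite G" using G finite_subset by blast
  have rec: "z $ k = (\<Sum>l\<in>G. C $$ (pos G k, pos G l) * (group_affine m G A b z $ l - b $ pos G l))"
    if "k \<in> G" for z k
  proof -
    have "(\<Sum>l\<in>G. C $$ (pos G k, pos G l) * (group_affine m G A b z $ l - b $ pos G l)) =
      (\<Sum>l\<in>G. \<Sum>j\<in>G. C $$ (pos G k, pos G l) * A $$ (pos G l, pos G j) * z $ j)"
      using G A b by (auto simp: group_affine_index sum_distrib_left mult.assoc intro!: sum.cong)
    also have "\<dots> = (\<Sum>j\<in>G. (\<Sum>l\<in>G. C $$ (pos G k, pos G l) * A $$ (pos G l, pos G j)) * z $ j)"
      by (subst sum.swap) (simp add: sum_distrib_right)
    also have "\<dots> = (\<Sum>j\<in>G. if k = j then z $ j else 0)"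
      using sum_mat_inverse[OF fin C A CA that] by (auto intro!: sum.cong)
    finally show ?thesis using fin that by simp
  qed
  have "x $ k = y $ k" if "k < m" for k
  proof (cases "k \<in> G")
    case True
    show ?thesis by (simp only: rec[OF True] eq)
  next
    case False
    then show ?thesis using group_affine_index_notin[OF that] eq by metis
  qed
  then show "x = y" using xy by (intro eq_vecI) auto
qed

text \<open>The inverse is given by choice through \<open>inv_into\<close>. Injectivity makes any
  exhibited preimage its value, so an explicit formula for the inverse can be avoided.\<close>

lemma group_affine_inv_eqI:
  assumes "G \<subseteq> {..<m}" "A \<in> carrier_mat (card G) (card G)" "b \<in> carrier_vec (card G)"
    and "C \<in> carrier_mat (card G) (card G)" "C * A = 1\<^sub>m (card G)"
    and "z \<in> carrier_vec m" "group_affine m G A b z = y"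
  shows "group_affine_inv m G A b y = z"
  unfolding group_affine_inv_def using inj_on_group_affine[OF assms(1-5)] assms(6,7)
  by (metis inv_into_f_f)

text \<open>Affine maps respect affine combinations: \<open>b\<close> cancels in the difference of
  the end points and survives once, through the starting point.\<close>

lemma group_affine_line:
  assumes "G \<subseteq> {..<m}" "A \<in> carrier_mat (card G) (card G)" "b \<in> carrier_vec (card G)"
    and x: "x \<in> carrier_vec m" "x' \<in> carrier_vec m"
  shows "group_affine m G A b x' + t \<cdot>\<^sub>v (group_affine m G A b x - group_affine m G A b x') =
    group_affine m G A b (x' + t \<cdot>\<^sub>v (x - x'))"
proof (rule eq_vecI)
  fix k assume "k < dim_vec (group_affine m G A b (x' + t \<cdot>\<^sub>v (x - x')))"
  then have k: "k < m" by simp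
  have ix: "(x' + t \<cdot>\<^sub>v (x - x')) $ l = x' $ l + t * (x $ l - x' $ l)" if "l < m" for l
    using x that by auto
  show "(group_affine m G A b x' + t \<cdot>\<^sub>v (group_affine m G A b x - group_affine m G A b x')) $ k =
      group_affine m G A b (x' + t \<cdot>\<^sub>v (x - x')) $ k"
  proof (cases "k \<in> G")
    case True
    have "(\<Sum>l\<in>G. A $$ (pos G k, pos G l) * (x' + t \<cdot>\<^sub>v (x - x')) $ l) =
      (\<Sum>l\<in>G. A $$ (pos G k, pos G l) * (x' $ l + t * (x $ l - x' $ l)))"
      using ix assms(1) by (intro sum.cong) auto
    then show ?thesis using k assms True
      by (simp add: group_affine_index algebra_simps sum.distrib sum_distrib_left sum_subtractf)
  qed (use k x in \<open>simp add: group_affine_index_notin\<close>)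
qed simp

text \<open>The direction is the column of the inverse matrix belonging to \<open>j\<close>,
  extended by zero outside the group. It is the direction that the linear part of the map sends to
  the unit vector of \<open>j\<close>.\<close>

lemma group_affine_column:
  assumes G: "G \<subseteq> {..<m}" and A: "A \<in> carrier_mat (card G) (card G)" and b: "b \<in> carrier_vec (card G)"
    and C: "C \<in> carrier_mat (card G) (card G)" and AC: "A * C = 1\<^sub>m (card G)"
    and p: "p \<in> carrier_vec m" and j: "j \<in> G"
  shows "group_affine m G A b
      (p + s \<cdot>\<^sub>v vec m (\<lambda>k. if k \<in> G then C $$ (pos G k, pos G j) else 0)) =
    group_affine m G A b p + s \<cdot>\<^sub>v unit_vec m j"
    (is "group_affine m G A b (p + s \<cdot>\<^sub>v ?w) = _")
proof (rule eq_vecI)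
  fix k assume "k < dim_vec (group_affine m G A b p + s \<cdot>\<^sub>v unit_vec m j)"
  then have k: "k < m" by simp
  have fin: "finite G" using G finite_subset by blast
  have jm: "j < m" using G j by auto
  show "group_affine m G A b (p + s \<cdot>\<^sub>v ?w) $ k =
      (group_affine m G A b p + s \<cdot>\<^sub>v unit_vec m j) $ k"
  proof (cases "k \<in> G")
    case True
    have "(\<Sum>l\<in>G. A $$ (pos G k, pos G l) * (p + s \<cdot>\<^sub>v ?w) $ l) =
      (\<Sum>l\<in>G. A $$ (pos G k, pos G l) * p $ l + s * (A $$ (pos G k, pos G l) * C $$ (pos G l, pos G j)))"
      using G p by (intro sum.cong) (auto simp: algebra_simps)
    also have "\<dots> = (\<Sum>l\<in>G. A $$ (pos G k, pos G l) * p $ l) + s * (if k = j then 1 else 0)"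
      using sum_mat_inverse[OF fin A C AC True j]
      by (simp add: sum.distrib sum_distrib_left[symmetric])
    finally show ?thesis using k jm G A b True
      by (simp add: group_affine_index)
  next
    case False
    then have "k \<noteq> j" using j by auto
    then show ?thesis using k jm p False by (simp add: group_affine_index_notin)
  qed
qed simp

section \<open>Directional derivatives and the chain rule\<close>

lemma euclid_norm_smult: "euclid_norm (s \<cdot>\<^sub>v w) = \<bar>s\<bar> * euclid_norm w"
  by (simp add: euclid_norm_def real_sqrt_mult)

lemma euclid_norm_nonneg: "0 \<le> euclid_norm w"
  by (auto simp: euclid_norm_def scalar_prod_def intro: sum_nonneg)

text \<open>The same gradient serves all directions \<open>w\<close>, so the directional derivative
  is linear in \<open>w\<close>. Existence of partial derivatives alone would not give this, and the
  chain rule below needs it for the columns of the inverse matrix.\<close>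

lemma differentiable_in_directional:
  assumes "differentiable_in m f x" and x: "x \<in> carrier_vec m"
  obtains g where "g \<in> carrier_vec m"
    "\<And>w. w \<in> carrier_vec m \<Longrightarrow> ((\<lambda>s. f (x + s \<cdot>\<^sub>v w)) has_field_derivative g \<bullet> w) (at 0)"
proof -
  obtain g where g: "g \<in> carrier_vec m"
    and D: "\<And>e. e > 0 \<Longrightarrow> \<exists>d > 0. \<forall>y \<in> carrier_vec m.
        euclid_norm (y - x) < d \<longrightarrow> \<bar>f y - f x - g \<bullet> (y - x)\<bar> \<le> e * euclid_norm (y - x)"
    using assms unfolding differentiable_in_def by blast
  have "((\<lambda>s. f (x + s \<cdot>\<^sub>v w)) has_field_derivative g \<bullet> w) (at 0)" if w: "w \<in> carrier_vec m" for w
    unfolding has_field_derivative_def has_derivative_at_alt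
  proof (intro conjI allI impI)
    fix e :: real assume e: "e > 0"
    define N where "N = euclid_norm w"
    have N: "N \<ge> 0" by (simp add: N_def euclid_norm_nonneg)
    \<comment> \<open>The summand 1 in \<open>N + 1\<close> keeps the divisor positive when
      \<open>w\<close> is the zero vector.\<close>
    obtain d where d: "d > 0" and dD: "\<And>y. y \<in> carrier_vec m \<Longrightarrow> euclid_norm (y - x) < d \<Longrightarrow>
        \<bar>f y - f x - g \<bullet> (y - x)\<bar> \<le> e / (N + 1) * euclid_norm (y - x)"
      using D[of "e / (N + 1)"] e N by (auto simp: add_nonneg_pos)
    show "\<exists>d>0. \<forall>y. norm (y - 0) < d \<longrightarrow>
        norm (f (x + y \<cdot>\<^sub>v w) - f (x + 0 \<cdot>\<^sub>v w) - g \<bullet> w * (y - 0)) \<le> e * norm (y - 0)"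
    proof (intro exI conjI allI impI)
      show "d / (N + 1) > 0" using d N by simp
      fix s :: real assume s: "norm (s - 0) < d / (N + 1)"
      have diff: "x + s \<cdot>\<^sub>v w - x = s \<cdot>\<^sub>v w" using x w by auto
      have zero: "x + 0 \<cdot>\<^sub>v w = x" using x w by auto
      have "\<bar>s\<bar> * (N + 1) < d" using s N by (simp add: pos_less_divide_eq)
      then have "\<bar>s\<bar> * N < d" using abs_ge_zero[of s] by (simp add: algebra_simps)
      then have "\<bar>f (x + s \<cdot>\<^sub>v w) - f x - g \<bullet> (s \<cdot>\<^sub>v w)\<bar> \<le> e / (N + 1) * (\<bar>s\<bar> * N)"
        using dD[of "x + s \<cdot>\<^sub>v w"] x w by (simp add: diff euclid_norm_smult N_def)
      also have "\<dots> = e * \<bar>s\<bar> * (N / (N + 1))" by simp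
      also have "\<dots> \<le> e * \<bar>s\<bar> * 1" using e N by (intro mult_left_mono) auto
      finally show "norm (f (x + s \<cdot>\<^sub>v w) - f (x + 0 \<cdot>\<^sub>v w) - g \<bullet> w * (s - 0)) \<le> e * norm (s - 0)"
        using g w by (simp add: zero mult.commute)
    qed
  qed (rule bounded_linear_mult_right)
  with g show thesis using that by blast
qed

text \<open>Under the inverse map, the line through the image of \<open>p\<close> in direction
  \<open>j\<close> becomes the line through \<open>p\<close> along a column of \<open>C\<close>. The
  partial derivative on the left is therefore a directional derivative of \<open>f\<close> at
  \<open>p\<close>, which expands linearly in the partial derivatives of \<open>f\<close>.\<close>

lemma partial_deriv_group_affine:
  assumes G: "G \<subseteq> {..<m}" and A: "A \<in> carrier_mat (card G) (card G)" and b: "b \<in> carrier_vec (card G)"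
    and C: "C \<in> carrier_mat (card G) (card G)" and AC: "A * C = 1\<^sub>m (card G)" and CA: "C * A = 1\<^sub>m (card G)"
    and p: "p \<in> carrier_vec m" and j: "j \<in> G" and diff: "differentiable_in m f p"
  shows "partial_deriv m (f \<circ> group_affine_inv m G A b) j (group_affine m G A b p) =
    (\<Sum>k\<in>G. C $$ (pos G k, pos G j) * partial_deriv m f k p)"
proof -
  let ?w = "vec m (\<lambda>k. if k \<in> G then C $$ (pos G k, pos G j) else 0)"
  obtain g where g: "g \<in> carrier_vec m"
    and D: "\<And>w. w \<in> carrier_vec m \<Longrightarrow> ((\<lambda>s. f (p + s \<cdot>\<^sub>v w)) has_field_derivative g \<bullet> w) (at 0)"
    using differentiable_in_directional[OF diff p] by blast
  have pd: "partial_deriv m f k p = g $ k" if "k < m" for k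
    unfolding partial_deriv_def using D[of "unit_vec m k", THEN DERIV_imp_deriv] g that by simp
  have inv: "group_affine_inv m G A b (group_affine m G A b p + s \<cdot>\<^sub>v unit_vec m j) = p + s \<cdot>\<^sub>v ?w" for s
    by (rule group_affine_inv_eqI[OF G A b C CA _ group_affine_column[OF G A b C AC p j]])
      (use p in simp)
  have "partial_deriv m (f \<circ> group_affine_inv m G A b) j (group_affine m G A b p) = g \<bullet> ?w"
    unfolding partial_deriv_def o_def inv by (rule DERIV_imp_deriv) (simp add: D)
  also have "\<dots> = (\<Sum>k\<in>{0..<m}. if k \<in> G then C $$ (pos G k, pos G j) * g $ k else 0)"
    using g by (auto simp: scalar_prod_def intro!: sum.cong)
  also have "\<dots> = (\<Sum>k\<in>G. C $$ (pos G k, pos G j) * g $ k)"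
    using G by (subst sum.inter_restrict[symmetric]) (auto intro!: sum.cong)
  finally show ?thesis using pd G by (auto intro!: sum.cong)
qed

lemma IG_group_affine_invariant:
  assumes G: "G \<subseteq> {..<m}" and A: "A \<in> carrier_mat (card G) (card G)" and b: "b \<in> carrier_vec (card G)"
    and C: "C \<in> carrier_mat (card G) (card G)" and AC: "A * C = 1\<^sub>m (card G)" and CA: "C * A = 1\<^sub>m (card G)"
    and x: "x \<in> carrier_vec m" "x' \<in> carrier_vec m" and wd: "IG_well_defined m G x x' f"
  shows "IG_group m G (group_affine m G A b x) (group_affine m G A b x')
    (f \<circ> group_affine_inv m G A b) = IG_group m G x x' f"
proof -
  let ?p = "\<lambda>t. x' + t \<cdot>\<^sub>v (x - x')" and ?h = "group_affine m G A b"
  let ?I = "\<lambda>k. integral {0..1} (\<lambda>t. partial_deriv m f k (?p t))"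
  have fin: "finite G" using G finite_subset by blast
  obtain N where N: "N \<in> null_sets lborel"
    "\<And>t. t \<in> {0..1} - N \<Longrightarrow> differentiable_in m f (?p t)"
    using wd unfolding IG_well_defined_def eventually_ae_filter by (auto simp: subset_eq)
  have neg: "negligible N"
    using N(1) negligible_iff_null_sets null_sets_completionI by blast
  have int: "(\<lambda>t. partial_deriv m f k (?p t)) integrable_on {0..1}" if "k \<in> G" for k
    using wd that by (simp add: IG_well_defined_def)
  have J: "integral {0..1} (\<lambda>t. partial_deriv m (f \<circ> group_affine_inv m G A b) j (?h x' + t \<cdot>\<^sub>v (?h x - ?h x')))
      = (\<Sum>k\<in>G. C $$ (pos G k, pos G j) * ?I k)" if j: "j \<in> G" for j
  proof -
    have "integral {0..1} (\<lambda>t. partial_deriv m (f \<circ> group_affine_inv m G A b) j (?h x' + t \<cdot>\<^sub>v (?h x - ?h x')))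
      = integral {0..1} (\<lambda>t. \<Sum>k\<in>G. C $$ (pos G k, pos G j) * partial_deriv m f k (?p t))"
    \<comment> \<open>The two integrands need agree only off \<open>N\<close>. On \<open>N\<close>
      the function may fail to be differentiable, and \<open>deriv\<close> may then return arbitrary
      values.\<close>
    proof (rule integral_spike[OF neg])
      fix t assume t: "t \<in> {0..1} - N"
      have "?p t \<in> carrier_vec m" using x by simp
      from partial_deriv_group_affine[OF G A b C AC CA this j N(2)[OF t]]
      show "(\<Sum>k\<in>G. C $$ (pos G k, pos G j) * partial_deriv m f k (?p t)) =
        partial_deriv m (f \<circ> group_affine_inv m G A b) j (?h x' + t \<cdot>\<^sub>v (?h x - ?h x'))"
        by (simp add: group_affine_line[OF G A b x])
    qed
    \<comment> \<open>Exchanging integral and sum relies on the integrability part of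
      \<open>IG_well_defined\<close>.\<close>
    also have "\<dots> = (\<Sum>k\<in>G. C $$ (pos G k, pos G j) * ?I k)"
      by (subst integral_sum[OF fin]) (auto intro: integrable_on_mult_right int)
    finally show ?thesis .
  qed
  have hdiff: "?h x $ j - ?h x' $ j = (\<Sum>l\<in>G. A $$ (pos G j, pos G l) * (x $ l - x' $ l))"
    if "j \<in> G" for j
    using that by (simp add: group_affine_index[OF G A b] sum_subtractf right_diff_distrib)
  have "IG_group m G (?h x) (?h x') (f \<circ> group_affine_inv m G A b) =
      (\<Sum>j\<in>G. (\<Sum>l\<in>G. A $$ (pos G j, pos G l) * (x $ l - x' $ l)) *
        (\<Sum>k\<in>G. C $$ (pos G k, pos G j) * ?I k))"
    unfolding IG_group_def IG_def by (rule sum.cong) (simp_all add: J hdiff)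
  \<comment> \<open>The sums are reordered until the one over \<open>j\<close> is innermost; that
    sum is an entry of \<open>C * A\<close>, and only the diagonal terms remain.\<close>
  also have "\<dots> = (\<Sum>j\<in>G. \<Sum>k\<in>G. \<Sum>l\<in>G.
      C $$ (pos G k, pos G j) * A $$ (pos G j, pos G l) * ((x $ l - x' $ l) * ?I k))"
    by (simp add: sum_product mult_ac) (intro sum.cong refl sum.swap)
  also have "\<dots> = (\<Sum>k\<in>G. \<Sum>j\<in>G. \<Sum>l\<in>G.
      C $$ (pos G k, pos G j) * A $$ (pos G j, pos G l) * ((x $ l - x' $ l) * ?I k))"
    by (rule sum.swap)
  also have "\<dots> = (\<Sum>k\<in>G. \<Sum>l\<in>G. \<Sum>j\<in>G.
      C $$ (pos G k, pos G j) * A $$ (pos G j, pos G l) * ((x $ l - x' $ l) * ?I k))"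
    by (intro sum.cong refl sum.swap)
  also have "\<dots> = (\<Sum>k\<in>G. \<Sum>l\<in>G. if k = l then (x $ l - x' $ l) * ?I k else 0)"
    by (intro sum.cong refl)
      (simp add: sum_distrib_right[symmetric] sum_mat_inverse[OF fin C A CA])
  also have "\<dots> = IG_group m G x x' f"
    using fin by (simp add: IG_group_def IG_def)
  finally show ?thesis .
qed

text \<open>The size of the inverse has to be read off from the two products: \<open>A * C\<close>
  fixes its number of columns and \<open>C * A\<close> its number of rows.\<close>

lemma invertible_matE:
  assumes "A \<in> carrier_mat n n" "invertible_mat A"
  obtains C where "C \<in> carrier_mat n n" "A * C = 1\<^sub>m n" "C * A = 1\<^sub>m n"
proof -
  obtain C where C: "A * C = 1\<^sub>m (dim_row A)" "C * A = 1\<^sub>m (dim_row C)"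
    using assms unfolding invertible_mat_def inverts_mat_def by blast
  have "dim_col (A * C) = n" using C(1) assms by simp
  moreover have "dim_col (C * A) = dim_row C" using C(2) by simp
  ultimately have "C \<in> carrier_mat n n" using assms by auto
  with C assms that show thesis by auto
qed

section \<open>Differentiability of the product of three coordinates\<close>

lemma component_le_euclid_norm:
  assumes "k < dim_vec d"
  shows "\<bar>d $ k\<bar> \<le> euclid_norm d"
proof -
  have "(d $ k)\<^sup>2 \<le> d \<bullet> d"
    unfolding scalar_prod_def power2_eq_square using assms by (intro member_le_sum) auto
  then show ?thesis unfolding euclid_norm_def by (metis real_le_rsqrt abs_le_square_iff real_sqrt_abs real_sqrt_le_mono)
qed

abbreviation coord_product :: "real vec \<Rightarrow> real" where
  "coord_product y \<equiv> y $ 0 * y $ 1 * y $ 2"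

text \<open>Expanding the product at \<open>x + d\<close> and removing the constant and linear terms
  leaves three quadratic terms in \<open>d\<close> and one cubic term, all of order at most the
  square of the norm of \<open>d\<close> when that norm is at most 1.\<close>

lemma differentiable_in_coord_product:
  assumes x: "x \<in> carrier_vec 3"
  shows "differentiable_in 3 coord_product x"
proof -
  define g where "g = vec_of_list [x $ 1 * x $ 2, x $ 0 * x $ 2, x $ 0 * x $ 1]"
  \<comment> \<open>\<open>K\<close> adds up the coefficients in the remainder estimate: one
    absolute value for each quadratic term, and 1 for the cubic term, whose last factor
    \<open>d $ 2\<close> is at most 1 in absolute value. The remainder is then at most
    \<open>N * K * N\<close>, which explains the radius \<open>min 1 (e / K)\<close>.\<close>
  define K where "K = \<bar>x $ 0\<bar> + \<bar>x $ 1\<bar> + \<bar>x $ 2\<bar> + 1"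
  have K: "K > 0" by (simp add: K_def add_nonneg_pos)
  have bound: "\<bar>coord_product y - coord_product x - g \<bullet> (y - x)\<bar> \<le> e * euclid_norm (y - x)"
    if y: "y \<in> carrier_vec 3" and e: "e > 0" and N: "euclid_norm (y - x) < min 1 (e / K)" for y e
  proof -
    define d where "d = y - x"
    define N where "N = euclid_norm d"
    have N0: "0 \<le> N" by (simp add: N_def euclid_norm_nonneg)
    have N1: "N \<le> 1" "N * K \<le> e" using N K by (auto simp: N_def d_def pos_less_divide_eq)
    have dk: "\<bar>d $ k\<bar> \<le> N" if "k < 3" for k
      unfolding N_def using x y that by (intro component_le_euclid_norm) (auto simp: d_def)
    have yk: "y $ k = x $ k + d $ k" if "k < 3" for k using x y that by (auto simp: d_def)
    have gd: "g \<bullet> d = x $ 1 * x $ 2 * d $ 0 + x $ 0 * x $ 2 * d $ 1 + x $ 0 * x $ 1 * d $ 2"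
      using x y by (simp add: scalar_prod_def g_def d_def eval_nat_numeral)
    have dd: "\<bar>d $ i * d $ j\<bar> \<le> N * N" if "i < 3" "j < 3" for i j
      using dk[OF that(1)] dk[OF that(2)] N0 by (simp add: abs_mult mult_mono)
    have t: "\<bar>d $ i * d $ j * c\<bar> \<le> N * N * \<bar>c\<bar>" if "i < 3" "j < 3" for i j c
      using dd[OF that] by (simp add: abs_mult[of "d $ i * d $ j" c] mult_right_mono)
    have "coord_product y - coord_product x - g \<bullet> d =
        d $ 0 * d $ 1 * x $ 2 + d $ 0 * d $ 2 * x $ 1 + d $ 1 * d $ 2 * x $ 0 + d $ 0 * d $ 1 * d $ 2"
      by (simp add: yk gd algebra_simps)
    also have "\<bar>\<dots>\<bar> \<le> N * N * \<bar>x $ 2\<bar> + N * N * \<bar>x $ 1\<bar> + N * N * \<bar>x $ 0\<bar> + N * N * \<bar>d $ 2\<bar>"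
      by (intro order_trans[OF abs_triangle_ineq] add_mono t) simp_all
    also have "\<dots> \<le> N * N * \<bar>x $ 2\<bar> + N * N * \<bar>x $ 1\<bar> + N * N * \<bar>x $ 0\<bar> + N * N * 1"
      using dk[of 2] N1 N0 by (intro add_left_mono mult_left_mono) auto
    also have "\<dots> = (N * K) * N" by (simp add: K_def algebra_simps)
    also have "\<dots> \<le> e * N" using N1 N0 by (intro mult_right_mono) auto
    finally show ?thesis by (simp add: N_def d_def)
  qed
  have g: "g \<in> carrier_vec 3" by (simp add: g_def carrier_vecI)
  show ?thesis unfolding differentiable_in_def
  proof (intro bexI[OF _ g] allI impI)
    fix e :: real assume e: "e > 0"
    show "\<exists>d>0. \<forall>y\<in>carrier_vec 3. euclid_norm (y - x) < d \<longrightarrow>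
        \<bar>coord_product y - coord_product x - g \<bullet> (y - x)\<bar> \<le> e * euclid_norm (y - x)"
      using e K bound by (intro exI[of _ "min 1 (e / K)"]) auto
  qed
qed

section \<open>Shears and the counterexample for Baseline Shapley\<close>

definition shear :: "real \<Rightarrow> real mat" where
  "shear c = mat 2 2 (\<lambda>(i, j). if i = j then 1 else if i = 0 then c else 0)"

lemma shear_carrier [simp]: "shear c \<in> carrier_mat 2 2"
  by (simp add: shear_def)

lemma shear_dim [simp]: "dim_row (shear c) = 2" "dim_col (shear c) = 2"
  by (simp_all add: shear_def)

text \<open>Shears form a one-parameter group, so \<open>shear (- c)\<close> is a two-sided inverse
  of \<open>shear c\<close>.\<close>

lemma shear_mult: "shear c * shear d = shear (c + d)"
  by (rule eq_matI) (auto simp: shear_def scalar_prod_def less_Suc_eq numeral_2_eq_2)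

lemma shear_index:
  "shear c $$ (0, 0) = 1" "shear c $$ (0, 1) = c" "shear c $$ (1, 0) = 0" "shear c $$ (1, 1) = 1"
  by (simp_all add: shear_def)

lemma shear_0: "shear 0 = 1\<^sub>m 2"
  by (rule eq_matI) (auto simp: shear_def)

lemma card_01: "card {0, 1::nat} = 2" "card {0, Suc 0} = 2"
  by auto

lemma pos_01: "pos {0, 1} 0 = 0" "pos {0, 1} 1 = 1"
proof -
  have "{j \<in> {0, 1::nat}. j < 1} = {0}" by auto
  then show "pos {0, 1} 1 = 1" by (simp add: pos_def)
qed (simp add: pos_def)

lemma group_affine_shear:
  assumes "y \<in> carrier_vec 3"
  shows "group_affine 3 {0, 1} (shear c) (0\<^sub>v 2) y = vec_of_list [y $ 0 + c * y $ 1, y $ 1, y $ 2]"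
proof (rule eq_vecI)
  fix k assume "k < dim_vec (vec_of_list [y $ 0 + c * y $ 1, y $ 1, y $ 2])"
  then consider "k = 0" | "k = 1" | "k = 2" by fastforce
  then show "group_affine 3 {0, 1} (shear c) (0\<^sub>v 2) y $ k =
      vec_of_list [y $ 0 + c * y $ 1, y $ 1, y $ 2] $ k"
    by cases (simp_all add: group_affine_index group_affine_index_notin pos_01 shear_index card_01
      vec_of_list_index del: One_nat_def vec_of_list_Cons)
qed simp

lemma group_affine_inv_shear:
  assumes "y \<in> carrier_vec 3"
  shows "group_affine_inv 3 {0, 1} (shear c) (0\<^sub>v 2) y = vec_of_list [y $ 0 - c * y $ 1, y $ 1, y $ 2]"
proof (rule group_affine_inv_eqI[where C = "shear (- c)"])
  let ?z = "vec_of_list [y $ 0 - c * y $ 1, y $ 1, y $ 2]"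
  show z: "?z \<in> carrier_vec 3" by (simp add: carrier_vecI)
  show "group_affine 3 {0, 1} (shear c) (0\<^sub>v 2) ?z = y"
    unfolding group_affine_shear[OF z]
    using assms by (intro eq_vecI) (auto simp: less_Suc_eq numeral_3_eq_3 numeral_2_eq_2)
qed (auto simp: shear_mult shear_0 card_01)

text \<open>For three players the Shapley weight is 1/3 when the coalition has 0 or 2 members and
  1/6 when it has one. The first row of the formula belongs to coordinate 0, the second to
  coordinate 1.\<close>

lemma BS_group_3:
  "BS_group 3 {0, 1} x x' f =
    (let v = (\<lambda>S. f (vec 3 (\<lambda>k. if k \<in> S then x $ k else x' $ k))) in
      (v {0} - v {}) / 3 + (v {0, 1} - v {1}) / 6 + (v {0, 2} - v {2}) / 6 + (v {0, 1, 2} - v {1, 2}) / 3 +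
      ((v {1} - v {}) / 3 + (v {0, 1} - v {0}) / 6 + (v {1, 2} - v {2}) / 6 + (v {0, 1, 2} - v {0, 2}) / 3))"
proof -
  define v where "v = (\<lambda>S. f (vec 3 (\<lambda>k. if k \<in> S then x $ k else x' $ k)))"
  have BS: "BS 3 j x x' f = (\<Sum>S \<in> Pow ({..<3} - {j}).
      fact (card S) * fact (3 - card S - 1) / fact 3 * (v (insert j S) - v S))" for j
    by (simp add: BS_def v_def Let_def)
  have M: "{..<3::nat} - {0} = {1, 2}" "{..<3::nat} - {1} = {0, 2}" by auto
  have P: "Pow {i, j} = {{}, {i}, {j}, {i, j}}" for i j :: nat by auto
  have "BS 3 0 x x' f =
      (v {0} - v {}) / 3 + (v {0, 1} - v {1}) / 6 + (v {0, 2} - v {2}) / 6 + (v {0, 1, 2} - v {1, 2}) / 3"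
    unfolding BS M P by (simp add: fact_numeral field_simps)
  moreover have "BS 3 1 x x' f =
      (v {1} - v {}) / 3 + (v {0, 1} - v {0}) / 6 + (v {1, 2} - v {2}) / 6 + (v {0, 1, 2} - v {0, 2}) / 3"
    unfolding BS M P by (simp add: fact_numeral insert_commute field_simps)
  ultimately show ?thesis by (simp add: BS_group_def v_def Let_def)
qed

lemma BS_group_not_affine_invariant:
  fixes x x' :: "real vec"
  defines "x \<equiv> vec 3 (\<lambda>_. 1)" and "x' \<equiv> 0\<^sub>v 3"
  shows "BS_group 3 {0, 1} x x' coord_product \<noteq>
    BS_group 3 {0, 1} (group_affine 3 {0, 1} (shear 1) (0\<^sub>v 2) x)
      (group_affine 3 {0, 1} (shear 1) (0\<^sub>v 2) x')
      (coord_product \<circ> group_affine_inv 3 {0, 1} (shear 1) (0\<^sub>v 2))"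
proof -
  have "x \<in> carrier_vec 3" "x' \<in> carrier_vec 3" by (simp_all add: x_def x'_def)
  note h = this[THEN group_affine_shear]
  \<comment> \<open>Only the full coalition has a nonzero value, namely 1, so each of the two group
    coordinates receives 1/3.\<close>
  have "BS_group 3 {0, 1} x x' coord_product = 2 / 3"
    unfolding BS_group_3 by (simp add: x_def x'_def)
  \<comment> \<open>The nonzero values are now -1 at \<open>{1, 2}\<close> and 1 at
    \<open>{0, 1, 2}\<close>. Coordinate 0 receives 2/3 and coordinate 1 receives -1/6 + 1/3; the
    negative value of \<open>{1, 2}\<close> carries different weights in the two attributions, so it
    does not cancel.\<close>
  moreover have "BS_group 3 {0, 1} (group_affine 3 {0, 1} (shear 1) (0\<^sub>v 2) x)
      (group_affine 3 {0, 1} (shear 1) (0\<^sub>v 2) x')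
      (coord_product \<circ> group_affine_inv 3 {0, 1} (shear 1) (0\<^sub>v 2)) = 5 / 6"
    unfolding BS_group_3 h Let_def o_apply group_affine_inv_shear[OF vec_carrier]
    by (simp add: x_def x'_def vec_of_list_index del: vec_of_list_Cons)
  ultimately show ?thesis by simp
qed

theorem proposition4p4:
  shows "(\<forall>m B Bi A b x x' f.
            m \<ge> 1 \<and> partition_on {..<m} B \<and> Bi \<in> B \<and>
            A \<in> carrier_mat (card Bi) (card Bi) \<and> invertible_mat A \<and> b \<in> carrier_vec (card Bi) \<and>
            x \<in> carrier_vec m \<and> x' \<in> carrier_vec m \<and>
            f \<in> ae_differentiable m \<and> IG_well_defined m Bi x x' f \<longrightarrow>
            IG_group m Bi x x' f =
              IG_group m Bi (group_affine m Bi A b x) (group_affine m Bi A b x')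
                (f \<circ> group_affine_inv m Bi A b))
       \<and> (\<exists>m B Bi A b x x' f.
            m \<ge> 1 \<and> partition_on {..<m} B \<and> Bi \<in> B \<and>
            A \<in> carrier_mat (card Bi) (card Bi) \<and> invertible_mat A \<and> b \<in> carrier_vec (card Bi) \<and>
            x \<in> carrier_vec m \<and> x' \<in> carrier_vec m \<and>
            f \<in> ae_differentiable m \<and>
            BS_group m Bi x x' f \<noteq>
              BS_group m Bi (group_affine m Bi A b x) (group_affine m Bi A b x')
                (f \<circ> group_affine_inv m Bi A b))"
proof (intro conjI allI impI)
  fix m B Bi x x' f and A :: "real mat" and b :: "real vec"
  assume H: "m \<ge> 1 \<and> partition_on {..<m} B \<and> Bi \<in> B \<and>
    A \<in> carrier_mat (card Bi) (card Bi) \<and> invertible_mat A \<and> b \<in> carrier_vec (card Bi) \<and>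
    x \<in> carrier_vec m \<and> x' \<in> carrier_vec m \<and>
    f \<in> ae_differentiable m \<and> IG_well_defined m Bi x x' f"
  then have "Bi \<subseteq> {..<m}" by (auto simp: partition_on_def)
  moreover obtain C where "C \<in> carrier_mat (card Bi) (card Bi)"
    "A * C = 1\<^sub>m (card Bi)" "C * A = 1\<^sub>m (card Bi)"
    using H invertible_matE by blast
  ultimately show "IG_group m Bi x x' f =
      IG_group m Bi (group_affine m Bi A b x) (group_affine m Bi A b x')
        (f \<circ> group_affine_inv m Bi A b)"
    using H by (intro IG_group_affine_invariant[symmetric]) auto
next
  have "partition_on {..<3} {{0, 1}, {2::nat}}"
    by (auto simp: partition_on_def disjoint_def)
  moreover have "invertible_mat (shear 1)"
    unfolding invertible_mat_def inverts_mat_def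
    by (auto simp: shear_mult shear_0 intro!: exI[of _ "shear (- 1)"])
  \<comment> \<open>The function is differentiable everywhere, so no exceptional null set has to be
    found.\<close>
  moreover have "coord_product \<in> ae_differentiable 3"
    unfolding ae_differentiable_def
    by (intro CollectI AE_I2 differentiable_in_coord_product vec_carrier)
  ultimately show "\<exists>m B Bi A b x x' f.
      m \<ge> 1 \<and> partition_on {..<m} B \<and> Bi \<in> B \<and>
      A \<in> carrier_mat (card Bi) (card Bi) \<and> invertible_mat A \<and> b \<in> carrier_vec (card Bi) \<and>
      x \<in> carrier_vec m \<and> x' \<in> carrier_vec m \<and>
      f \<in> ae_differentiable m \<and>
      BS_group m Bi x x' f \<noteq>
        BS_group m Bi (group_affine m Bi A b x) (group_affine m Bi A b x')
          (f \<circ> group_affine_inv m Bi A b)"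
    by - (rule exI[of _ 3], rule exI[of _ "{{0, 1}, {2}}"], rule exI[of _ "{0, 1}"],
        rule exI[of _ "shear 1"], rule exI[of _ "0\<^sub>v 2"], rule exI[of _ "vec 3 (\<lambda>_. 1)"],
        rule exI[of _ "0\<^sub>v 3"], rule exI[of _ coord_product],
        intro conjI BS_group_not_affine_invariant, simp_all add: card_01)
qed

end
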